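(* Let $(G,q_1)$ and $(\Gamma,q_2)$ be metric groups such that $G_2=\{0,g_0\}\cong\mathbb{Z}_2$, $\Gamma_2=\{0,\gamma_0\}\cong\mathbb{Z}_2$, $c:=\mathcal{G}(q_1)=-\mathcal{G}(q_2)$, $\langle g_0,g_0\rangle=-\langle\gamma_0,\gamma_0\rangle$, and $c^2=q_1(g_0)^{-1}q_2(\gamma_0)$. Let $S$ be the $J\times J$ matrix defined in the context and let $$N_{i,j,k}=\sum_{w\in J}\frac{S_{w,i}S_{w,j}S_{w,k}}{S_{0,w}}\qquad(i,j,k\in J).$$ Then all the numbers $N_{i,j,k}$ are non-negative integers if and only if $|\Gamma|-|G|=2$.
   Context: A metric group $(G,q)$ is a finite abelian group $G$ with a map $q:G\to\mathbb{T}=\{z\in\mathbb{C}:|z|=1\}$ such that $q(-g)=q(g)$ and $\langle g,h\rangle=q(g+h)q(g)^{-1}q(h)^{-1}$ is a non-degenerate bicharacter. $\mathcal{G}(q)=\frac{1}{\sqrt{|G|}}\sum_{g\in G}q(g)$. $G_2=\{g\in G:2g=0\}$. Put $s=c\,\frac{q_1(g_0)^{-1}+q_2(\gamma_0)^{-1}}{\sqrt2}$, $a=1/\sqrt{|G|}$, $b=1/\sqrt{|\Gamma|}$. Fix $G_*\subset G$, $\Gamma_*\subset\Gamma$ with $G=G_2\sqcup G_*\sqcup(-G_* )$, $\Gamma=\Gamma_2\sqcup\Gamma_*\sqcup(-\Gamma_* )$. Let $J_1=\{g_0\}\times\{1,-1\}$, $J_2=\{\gamma_0\}\times\{1,-1\}$,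 $J=\{0,\pi\}\sqcup J_1\sqcup G_*\sqcup J_2\sqcup\Gamma_*$. With blocks indexed in order by $\{0\},\{\pi\},J_1,G_*,J_2,\Gamma_*$ (row indices $0,\pi,(g_0,\varepsilon),g,(\gamma_0,\varepsilon),\gamma$; column indices with primes): $$S=\begin{pmatrix} \frac{a-b}{2}&\frac{a+b}{2}&\frac{a}{2}&a&\frac{b}{2}&b\\ \frac{a+b}{2}&\frac{a-b}{2}&\frac{a}{2}&a&-\frac{b}{2}&-b\\ \frac{a}{2}&\frac{a}{2}&(\frac{a}{2}+\frac{\varepsilon\varepsilon's}{2\sqrt{2}})\langle g_0,g_0\rangle&a\langle g_0,g'\rangle&\frac{\varepsilon\varepsilon's}{2\sqrt{2}}&0\\ a&a&a\langle g,g_0\rangle&a(\langle g,g'\rangle+\overline{\langle g,g'\rangle})&0&0\\ \frac{b}{2}&-\frac{b}{2}&\frac{\varepsilon\varepsilon's}{2\sqrt{2}}&0&-(\frac{b}{2}-\frac{\varepsilon\varepsilon's}{2\sqrt{2}})\langle\gamma_0,\gamma_0\rangle&-b\langle\gamma_0,\gamma'\rangle\\ b&-b&0&0&-b\langle\gamma,\gamma_0\rangle&-b(\langle\gamma,\gamma'\rangle+\overline{\langle\gamma,\gamma'\rangle}) \end{pmatrix}.$$ *)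

theory Defs
  imports "HOL-Analysis.Analysis"
begin

definition bichar :: "('g::ab_group_add \<Rightarrow> complex) \<Rightarrow> 'g \<Rightarrow> 'g \<Rightarrow> complex" where
  "bichar q g h = q (g + h) * inverse (q g) * inverse (q h)"

text \<open>
  A finite abelian group is a type of class \<open>finite\<close> and \<open>ab_group_add\<close>.  Non-degeneracy is stated
  in one argument only, because \<^const>\<open>bichar\<close> is symmetric.
\<close>

definition metric_group :: "('g::{finite, ab_group_add} \<Rightarrow> complex) \<Rightarrow> bool" where
  "metric_group q \<longleftrightarrow>
     (\<forall>g. cmod (q g) = 1) \<and>
     (\<forall>g. q (- g) = q g) \<and>
     (\<forall>g g' h. bichar q (g + g') h = bichar q g h * bichar q g' h) \<and>
     (\<forall>g h h'. bichar q g (h + h') = bichar q g h * bichar q g h') \<and>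
     (\<forall>g. (\<forall>h. bichar q g h = 1) \<longrightarrow> g = 0)"

definition gauss_sum :: "('g::{finite, ab_group_add} \<Rightarrow> complex) \<Rightarrow> complex" where
  "gauss_sum q = 1 / of_real (sqrt (real CARD('g))) * (\<Sum>g\<in>UNIV. q g)"

definition two_torsion :: "'g::ab_group_add set" where
  "two_torsion = {g. g + g = 0}"

definition half_system :: "'g::ab_group_add set \<Rightarrow> bool" where
  "half_system H \<longleftrightarrow>
     two_torsion \<union> H \<union> uminus ` H = UNIV \<and>
     two_torsion \<inter> H = {} \<and> two_torsion \<inter> uminus ` H = {} \<and> H \<inter> uminus ` H = {}"

text \<open>
  The constructors tag the six summands of the disjoint union \<open>J\<close>; the second component of a
  \<open>J1\<close> or \<open>J2\<close> index is the sign \<open>\<epsilon>\<close>.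
\<close>

datatype ('g, 'h) idx = IdxZero | IdxPi | J1 "'g \<times> int" | Gstar 'g | J2 "'h \<times> int" | Gammastar 'h

definition J :: "'g \<Rightarrow> 'h \<Rightarrow> 'g set \<Rightarrow> 'h set \<Rightarrow> ('g, 'h) idx set" where
  "J g0 \<gamma>0 Gs \<Gamma>s =
     {IdxZero, IdxPi} \<union> J1 ` ({g0} \<times> {1, -1}) \<union> Gstar ` Gs \<union> J2 ` ({\<gamma>0} \<times> {1, -1}) \<union> Gammastar ` \<Gamma>s"

context
  fixes q1 :: "'g::{finite, ab_group_add} \<Rightarrow> complex"
    and q2 :: "'h::{finite, ab_group_add} \<Rightarrow> complex"
    and g0 :: 'g and \<gamma>0 :: 'h
begin

definition s_val :: complex where
  "s_val = gauss_sum q1 * (inverse (q1 g0) + inverse (q2 \<gamma>0)) / of_real (sqrt 2)"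

definition a_val :: complex where
  "a_val = 1 / of_real (sqrt (real CARD('g)))"

definition b_val :: complex where
  "b_val = 1 / of_real (sqrt (real CARD('h)))"

text \<open>
  The entries of the off-diagonal blocks joining \<open>J1\<close> and \<open>J2\<close>, and the corresponding terms of
  the two diagonal blocks.
\<close>

definition t_val :: "int \<Rightarrow> int \<Rightarrow> complex" where
  "t_val \<epsilon> \<epsilon>' = of_int \<epsilon> * of_int \<epsilon>' * s_val / (2 * of_real (sqrt 2))"

fun S_mat :: "('g, 'h) idx \<Rightarrow> ('g, 'h) idx \<Rightarrow> complex" where
  "S_mat IdxZero IdxZero = (a_val - b_val) / 2"
| "S_mat IdxZero IdxPi = (a_val + b_val) / 2"
| "S_mat IdxZero (J1 _) = a_val / 2"
| "S_mat IdxZero (Gstar _) = a_val"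
| "S_mat IdxZero (J2 _) = b_val / 2"
| "S_mat IdxZero (Gammastar _) = b_val"

| "S_mat IdxPi IdxZero = (a_val + b_val) / 2"
| "S_mat IdxPi IdxPi = (a_val - b_val) / 2"
| "S_mat IdxPi (J1 _) = a_val / 2"
| "S_mat IdxPi (Gstar _) = a_val"
| "S_mat IdxPi (J2 _) = - (b_val / 2)"
| "S_mat IdxPi (Gammastar _) = - b_val"

| "S_mat (J1 _) IdxZero = a_val / 2"
| "S_mat (J1 _) IdxPi = a_val / 2"
| "S_mat (J1 (_, \<epsilon>)) (J1 (_, \<epsilon>')) = (a_val / 2 + t_val \<epsilon> \<epsilon>') * bichar q1 g0 g0"
| "S_mat (J1 _) (Gstar g') = a_val * bichar q1 g0 g'"
| "S_mat (J1 (_, \<epsilon>)) (J2 (_, \<epsilon>')) = t_val \<epsilon> \<epsilon>'"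
| "S_mat (J1 _) (Gammastar _) = 0"

| "S_mat (Gstar _) IdxZero = a_val"
| "S_mat (Gstar _) IdxPi = a_val"
| "S_mat (Gstar g) (J1 _) = a_val * bichar q1 g g0"
| "S_mat (Gstar g) (Gstar g') = a_val * (bichar q1 g g' + cnj (bichar q1 g g'))"
| "S_mat (Gstar _) (J2 _) = 0"
| "S_mat (Gstar _) (Gammastar _) = 0"

| "S_mat (J2 _) IdxZero = b_val / 2"
| "S_mat (J2 _) IdxPi = - (b_val / 2)"
| "S_mat (J2 (_, \<epsilon>)) (J1 (_, \<epsilon>')) = t_val \<epsilon> \<epsilon>'"
| "S_mat (J2 _) (Gstar _) = 0"
| "S_mat (J2 (_, \<epsilon>)) (J2 (_, \<epsilon>')) = - (b_val / 2 - t_val \<epsilon> \<epsilon>') * bichar q2 \<gamma>0 \<gamma>0"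
| "S_mat (J2 _) (Gammastar \<gamma>') = - b_val * bichar q2 \<gamma>0 \<gamma>'"

| "S_mat (Gammastar _) IdxZero = b_val"
| "S_mat (Gammastar _) IdxPi = - b_val"
| "S_mat (Gammastar _) (J1 _) = 0"
| "S_mat (Gammastar _) (Gstar _) = 0"
| "S_mat (Gammastar \<gamma>) (J2 _) = - b_val * bichar q2 \<gamma> \<gamma>0"
| "S_mat (Gammastar \<gamma>) (Gammastar \<gamma>') =
     - b_val * (bichar q2 \<gamma> \<gamma>' + cnj (bichar q2 \<gamma> \<gamma>'))"

end

text \<open>
  \<open>z\<close> is the index written 0 in the denominators.  For \<open>S_mat\<close> with \<open>z = IdxZero\<close> the only denominator
  that could vanish is \<open>(a_val - b_val) / 2\<close>.  It does not: \<open>bichar q1 g0 g0 = - bichar q2 \<gamma>0 \<gamma>0\<close> for the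
  unique involutions forces one of the two group orders to be 2 modulo 4 and the other one to be
  divisible by 4, so the orders differ.
\<close>

definition verlinde :: "'i set \<Rightarrow> ('i \<Rightarrow> 'i \<Rightarrow> complex) \<Rightarrow> 'i \<Rightarrow> 'i \<Rightarrow> 'i \<Rightarrow> 'i \<Rightarrow> complex" where
  "verlinde I S z i j k = (\<Sum>w\<in>I. S w i * S w j * S w k / S z w)"

end

theory Submission
  imports Defs
begin

text \<open>
  Up to scalars, the column of \<open>S\<close> at \<open>i\<close> consists of values of a function \<open>f i\<close> on \<open>G\<close> and a function
  \<open>h i\<close> on \<open>\<Gamma>\<close>, both sums of characters, perturbed by terms \<open>\<plusminus>\<sigma>\<close> in the rows \<open>J1\<close> and \<open>J2\<close>, where
  \<open>8 \<sigma>\<^sup>2 = \<langle>g0, g0\<rangle> = \<plusminus>1\<close>.  Since \<open>f i\<close> and \<open>h i\<close> are even, the sums over the half systems become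
  sums over the whole groups, and orthogonality of characters turns these into counts \<open>PG\<close>, \<open>PH\<close> of
  solutions of \<open>x + y + z = 0\<close>.  With \<open>d = |\<Gamma>| - |G| \<noteq> 0\<close> the remaining terms combine to
  \<open>N i j k = (f i 0 + h i 0) (f j 0 + h j 0) (f k 0 + h k 0) / (2 d) + (PG i j k - PH i j k) / 2 + K i j k / 4\<close>,
  where \<open>K\<close> comes from \<open>\<sigma>\<close>.  Taking \<open>(\<pi>, \<pi>, J1)\<close> and \<open>(\<pi>, J1, J1)\<close> gives \<open>2 / d\<close> and
  \<open>1 / d + 1 / 2\<close>, which are both natural only for \<open>d = 2\<close>; conversely, for \<open>d = 2\<close> every value of the
  formula is seen to be natural, because the solutions of \<open>x + y + z = 0\<close> come in pairs \<open>\<plusminus>(x, y, z)\<close> and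
  there are few of them.
\<close>

section \<open>Sums over half systems and orthogonality of characters\<close>

lemma sum_half_system:
  fixes u :: "'g::{finite, ab_group_add} \<Rightarrow> complex"
  assumes H: "half_system H" and T: "two_torsion = {0, t}" "t \<noteq> 0"
    and even: "\<And>w. u (- w) = u w"
  shows "(\<Sum>w\<in>UNIV. u w) = u 0 + u t + 2 * (\<Sum>w\<in>H. u w)"
proof -
  have U: "UNIV = {0, t} \<union> (H \<union> uminus ` H)" and D: "{0, t} \<inter> (H \<union> uminus ` H) = {}"
    and HH: "H \<inter> uminus ` H = {}"
    using H T unfolding half_system_def by auto
  have "(\<Sum>w\<in>UNIV. u w) = (\<Sum>w\<in>{0, t}. u w) + (\<Sum>w\<in>H \<union> uminus ` H. u w)"
    by (subst U, rule sum.union_disjoint) (use D in auto)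
  also have "(\<Sum>w\<in>H \<union> uminus ` H. u w) = (\<Sum>w\<in>H. u w) + (\<Sum>w\<in>uminus ` H. u w)"
    by (rule sum.union_disjoint) (use HH in auto)
  also have "(\<Sum>w\<in>uminus ` H. u w) = (\<Sum>w\<in>H. u w)"
    by (subst sum.reindex) (auto simp: even)
  also have "(\<Sum>w\<in>{0, t}. u w) = u 0 + u t" using T(2) by simp
  finally show ?thesis by simp
qed

lemma bichar_commute: "bichar q g h = bichar q h g"
  by (simp add: bichar_def add.commute mult.commute mult.left_commute)

context
  fixes q :: "'g::{finite, ab_group_add} \<Rightarrow> complex"
  assumes mg: "metric_group q"
begin

lemma bichar_add_left: "bichar q (g + g') h = bichar q g h * bichar q g' h"
  and bichar_add_right: "bichar q g (h + h') = bichar q g h * bichar q g h'"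
  and bichar_nondegenerate: "(\<And>h. bichar q g h = 1) \<Longrightarrow> g = 0"
  using mg unfolding metric_group_def by blast+

lemma cmod_bichar: "cmod (bichar q g h) = 1"
  using mg by (simp add: metric_group_def bichar_def norm_mult norm_inverse)

lemma bichar_nonzero: "bichar q g h \<noteq> 0"
  using cmod_bichar[of g h] by auto

lemma bichar_zero_right [simp]: "bichar q g 0 = 1"
  using bichar_add_right[of g 0 0] bichar_nonzero[of g 0] by simp

lemma bichar_zero_left [simp]: "bichar q 0 g = 1"
  by (subst bichar_commute) simp

lemma bichar_minus_mult: "bichar q g h * bichar q g (- h) = 1"
  using bichar_add_right[of g h "- h"] by simp

lemma cnj_bichar: "cnj (bichar q g h) = bichar q g (- h)"
proof -
  have "cnj (bichar q g h) * bichar q g h = 1"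
    using complex_norm_square[of "bichar q g h"] by (simp add: cmod_bichar mult.commute)
  then show ?thesis
    using bichar_minus_mult[of g h] bichar_nonzero[of g h]
    by (metis mult.commute mult_right_cancel)
qed

lemma bichar_minus_left: "bichar q (- g) h = bichar q g (- h)"
  by (metis bichar_commute cnj_bichar)

lemma quadratic_zero: "q 0 = 1"
  using bichar_zero_right[of 0] by (cases "q 0 = 0") (simp_all add: bichar_def)

lemma bichar_involution:
  assumes "t + t = 0"
  shows "bichar q t g = 1 \<or> bichar q t g = -1" "bichar q g t = 1 \<or> bichar q g t = -1"
proof -
  have "(bichar q t g)\<^sup>2 = 1"
    using bichar_add_left[of t t g] assms by (simp add: power2_eq_square)
  then show "bichar q t g = 1 \<or> bichar q t g = -1" by (simp add: power2_eq_1_iff)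
  then show "bichar q g t = 1 \<or> bichar q g t = -1" by (simp add: bichar_commute)
qed

text \<open>For \<open>x \<noteq> 0\<close> non-degeneracy supplies \<open>h\<close> with
  \<open>bichar q x h \<noteq> 1\<close>. Replacing \<open>w\<close> by \<open>w + h\<close>
  multiplies the sum by this factor without changing it, so the sum vanishes.\<close>

lemma sum_bichar: "(\<Sum>w\<in>UNIV. bichar q w x) = (if x = 0 then of_nat CARD('g) else 0)"
proof (cases "x = 0")
  case False
  then obtain h where h: "bichar q x h \<noteq> 1" using bichar_nondegenerate by blast
  have "(\<Sum>w\<in>UNIV. bichar q w x) = (\<Sum>w\<in>UNIV. bichar q (w + h) x)"
    by (rule sum.reindex_bij_witness[where i = "\<lambda>w. w + h" and j = "\<lambda>w. w - h"]) auto
  also have "\<dots> = (\<Sum>w\<in>UNIV. bichar q w x) * bichar q x h"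
    by (simp add: bichar_add_left sum_distrib_right bichar_commute[of q h])
  finally show ?thesis using h False by simp
qed simp

definition chars :: "'g list \<Rightarrow> 'g \<Rightarrow> complex" where
  "chars xs w = (\<Sum>x\<leftarrow>xs. bichar q w x)"

lemma chars_simps [simp]: "chars [] w = 0" "chars (x # xs) w = bichar q w x + chars xs w"
  by (simp_all add: chars_def)

lemma chars_zero: "chars xs 0 = of_nat (length xs)"
  by (induction xs) auto

end

section \<open>Counting solutions of \<open>x + y + z = 0\<close>\<close>

definition zero_sums :: "'g::ab_group_add list \<Rightarrow> 'g list \<Rightarrow> 'g list \<Rightarrow> nat" where
  "zero_sums xs ys zs = (\<Sum>x\<leftarrow>xs. \<Sum>y\<leftarrow>ys. \<Sum>z\<leftarrow>zs. if x + y + z = 0 then 1 else 0)"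

text \<open>Expanding the product gives the characters belonging to \<open>x + y + z\<close>; by
  orthogonality only those with \<open>x + y + z = 0\<close> survive, each contributing the group
  order.\<close>

lemma sum_chars:
  fixes q :: "'g::{finite, ab_group_add} \<Rightarrow> complex"
  assumes "metric_group q"
  shows "(\<Sum>w\<in>UNIV. chars q xs w * chars q ys w * chars q zs w)
       = of_nat CARD('g) * of_nat (zero_sums xs ys zs)"
proof -
  have 1: "(\<Sum>w\<in>UNIV. bichar q w x * bichar q w y * chars q zs w)
     = of_nat CARD('g) * of_nat (\<Sum>z\<leftarrow>zs. if x + y + z = 0 then 1 else 0)" for x y
  proof (induction zs)
    case (Cons z zs)
    have "(\<Sum>w\<in>UNIV. bichar q w x * bichar q w y * bichar q w z) = (\<Sum>w\<in>UNIV. bichar q w (x + y + z))"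
      by (simp add: bichar_add_right[OF assms])
    then show ?case using Cons sum_bichar[OF assms, of "x + y + z"]
      by (simp add: assms distrib_left sum.distrib)
  qed (simp add: assms)
  have 2: "(\<Sum>w\<in>UNIV. bichar q w x * chars q ys w * chars q zs w)
     = of_nat CARD('g) * of_nat (\<Sum>y\<leftarrow>ys. \<Sum>z\<leftarrow>zs. if x + y + z = 0 then 1 else 0)" for x
    by (induction ys) (use 1 in \<open>simp_all add: assms distrib_left distrib_right sum.distrib\<close>)
  show ?thesis unfolding zero_sums_def
    by (induction xs) (use 2 in \<open>simp_all add: assms distrib_left distrib_right sum.distrib\<close>)
qed

lemma zero_sums_Nil [simp]: "zero_sums [] ys zs = 0" "zero_sums xs [] zs = 0" "zero_sums xs ys [] = 0"
  by (simp_all add: zero_sums_def)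

text \<open>Doubling \<open>t + u + w = 0\<close> removes \<open>t\<close> and \<open>u\<close> and
  leaves \<open>w + w = 0\<close>, which fails for \<open>w = z\<close> and
  \<open>w = - z\<close>.\<close>

lemma zero_sums_involution2:
  fixes t u z :: "'g::ab_group_add"
  assumes "t + t = 0" "u + u = 0" "z + z \<noteq> 0"
  shows "zero_sums [t] [u] [z, - z] = 0"
proof -
  have *: "t + u + w \<noteq> 0" if "w + w \<noteq> 0" for w
  proof -
    have "(t + u + w) + (t + u + w) = (t + t) + (u + u) + (w + w)" by (simp add: algebra_simps)
    also have "\<dots> = w + w" by (simp only: assms add_0)
    finally show ?thesis using that by (metis add_0)
  qed
  have "- z + - z \<noteq> 0" using assms(3) by (metis minus_add_distrib neg_equal_0_iff_equal)
  then show ?thesis using *[of z] *[of "- z"] assms(3) by (simp add: zero_sums_def)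
qed

text \<open>Since \<open>- t = t\<close>, negation pairs the four sign choices. Only one pair can
  consist of solutions: subtracting \<open>t + y - z = 0\<close> from \<open>t + y + z = 0\<close>
  would give \<open>z + z = 0\<close>.\<close>

lemma zero_sums_involution1:
  fixes t y z :: "'g::ab_group_add"
  assumes "t + t = 0" "z + z \<noteq> 0"
  shows "zero_sums [t] [y, - y] [z, - z] \<in> {0, 2}"
proof -
  have t: "- t = t" using assms by (simp add: minus_unique)
  have neg: "t - y + w = 0 \<longleftrightarrow> t + y - w = 0" for w
  proof -
    have "t - y + w = - (t + y - w)" by (subst (1) t[symmetric]) (simp add: algebra_simps)
    then show ?thesis by (metis neg_equal_0_iff_equal)
  qed
  have "t + y + z = 0 \<Longrightarrow> t + y - z = 0 \<Longrightarrow> False"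
  proof -
    assume "t + y + z = 0" "t + y - z = 0"
    then have "(t + y + z) - (t + y - z) = 0" by simp
    then show False using assms by simp
  qed
  then show ?thesis using neg[of z] neg[of "- z"] by (auto simp: zero_sums_def)
qed

text \<open>Negation groups the eight sign choices into four pairs. For each of
  \<open>v = x + y\<close> and \<open>v = x - y\<close>, at most one of \<open>v + z\<close> and
  \<open>v - z\<close> is 0, so at most two pairs consist of solutions.\<close>

lemma zero_sums_no_involution:
  fixes x y z :: "'g::ab_group_add"
  assumes "z + z \<noteq> 0"
  shows "zero_sums [x, - x] [y, - y] [z, - z] \<in> {0, 2, 4}"
proof -
  have neg: "- x + v + w = 0 \<longleftrightarrow> x - v - w = 0" for v w
  proof -
    have "- x + v + w = - (x - v - w)" by simp
    then show ?thesis by (metis neg_equal_0_iff_equal)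
  qed
  have "v + z = 0 \<Longrightarrow> v - z = 0 \<Longrightarrow> False" for v
  proof -
    assume "v + z = 0" "v - z = 0"
    then have "(v + z) - (v - z) = 0" by simp
    then show False using assms by simp
  qed
  from this[of "x + y"] this[of "x - y"]
  show ?thesis using neg[of y z] neg[of y "- z"] neg[of "- y" z] neg[of "- y" "- z"]
    by (auto simp: zero_sums_def)
qed

text \<open>The two swaps generate all permutations of three arguments, so a triple may be sorted by
  \<open>r\<close>.\<close>

lemma symmetric_wlog:
  fixes r :: "'a \<Rightarrow> nat"
  assumes "\<And>i j k. P i j k \<Longrightarrow> P j i k" "\<And>i j k. P i j k \<Longrightarrow> P i k j"
    and "\<And>i j k. r i \<le> r j \<Longrightarrow> r j \<le> r k \<Longrightarrow> P i j k"
  shows "P i j k"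
  by (meson assms nat_le_linear)

section \<open>Two metric groups and the constant \<open>\<sigma>\<close>\<close>

locale metric_pair =
  fixes q1 :: "'g::{finite, ab_group_add} \<Rightarrow> complex"
    and q2 :: "'h::{finite, ab_group_add} \<Rightarrow> complex"
    and g0 :: 'g and \<gamma>0 :: 'h
    and Gs :: "'g set" and \<Gamma>s :: "'h set"
  assumes mg1: "metric_group q1" and mg2: "metric_group q2"
    and tors1: "two_torsion = {0, g0}" and g0: "g0 \<noteq> 0"
    and tors2: "two_torsion = {0, \<gamma>0}" and \<gamma>0: "\<gamma>0 \<noteq> 0"
    and opp: "bichar q1 g0 g0 = - bichar q2 \<gamma>0 \<gamma>0"
    and gauss: "(gauss_sum q1)\<^sup>2 = inverse (q1 g0) * q2 \<gamma>0"
    and half1: "half_system Gs" and half2: "half_system \<Gamma>s"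
begin

abbreviation "S \<equiv> S_mat q1 q2 g0 \<gamma>0"
abbreviation "I \<equiv> J g0 \<gamma>0 Gs \<Gamma>s"
abbreviation "N \<equiv> verlinde I S IdxZero"
definition a :: complex where "a = a_val TYPE('g)"
definition b :: complex where "b = b_val TYPE('h)"

definition e :: complex where "e = bichar q1 g0 g0"
definition \<sigma> :: complex where "\<sigma> = s_val q1 q2 g0 \<gamma>0 / (2 * of_real (sqrt 2))"

lemma double_g0 [simp]: "g0 + g0 = 0" and double_\<gamma>0 [simp]: "\<gamma>0 + \<gamma>0 = 0"
  using tors1 tors2 unfolding two_torsion_def by blast+

lemma uminus_g0 [simp]: "- g0 = g0" and uminus_\<gamma>0 [simp]: "- \<gamma>0 = \<gamma>0"
  by (simp_all add: minus_unique)

lemma e_cases: "e = 1 \<or> e = -1"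
  unfolding e_def by (rule bichar_involution[OF mg1]) simp

lemma bichar_g0: "bichar q1 g0 g0 = e" and bichar_\<gamma>0: "bichar q2 \<gamma>0 \<gamma>0 = - e"
  using opp by (simp_all add: e_def)

text \<open>As \<open>q1 0 = q2 0 = 1\<close>, the squares of \<open>inverse (q1 g0)\<close> and
  \<open>inverse (q2 \<gamma>0)\<close> are \<open>e\<close> and \<open>- e\<close>. They cancel in
  the squared sum, and the cross term times \<open>(gauss_sum q1)\<^sup>2\<close> is
  \<open>2 * e\<close>.\<close>

lemma sigma_sq: "\<sigma> * \<sigma> = e / 8"
proof -
  define x y where "x = q1 g0" and "y = q2 \<gamma>0"
  have nz: "x \<noteq> 0" "y \<noteq> 0"
    using mg1 mg2 unfolding x_def y_def metric_group_def by (metis norm_zero zero_neq_one)+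
  have e: "e = inverse x * inverse x" "- e = inverse y * inverse y"
    using bichar_g0 bichar_\<gamma>0
    by (simp_all add: bichar_def quadratic_zero[OF mg1] quadratic_zero[OF mg2] x_def y_def)
  have r: "(of_real (sqrt 2) :: complex)\<^sup>2 = 2"
    by (metis of_real_numeral of_real_power real_sqrt_pow2 zero_le_numeral)
  have "\<sigma> * \<sigma> = (gauss_sum q1)\<^sup>2 * (inverse x + inverse y)\<^sup>2
      / (of_real (sqrt 2))\<^sup>2 / (2\<^sup>2 * (of_real (sqrt 2))\<^sup>2)"
    by (simp add: \<sigma>_def s_val_def x_def y_def power2_eq_square mult_ac)
  also have "\<dots> = (inverse x * y) * (inverse x * inverse x + inverse y * inverse y + 2 * (inverse x * inverse y)) / 16"
    unfolding gauss r by (simp add: x_def y_def power2_eq_square algebra_simps)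
  also have "\<dots> = (inverse x * y) * (2 * (inverse x * inverse y)) / 16"
    using e by (metis add.right_inverse add_0)
  also have "\<dots> = e / 8" using nz unfolding e by simp
  finally show ?thesis .
qed

lemma t_val_eq: "t_val q1 q2 g0 \<gamma>0 \<epsilon> \<epsilon>' = of_int \<epsilon> * of_int \<epsilon>' * \<sigma>"
  by (simp add: t_val_def \<sigma>_def)

lemma a_sq: "a * a = 1 / of_nat CARD('g)" and b_sq: "b * b = 1 / of_nat CARD('h)"
  by (simp_all add: a_def b_def a_val_def b_val_def flip: of_real_mult)

lemma a_nonzero: "a \<noteq> 0" and b_nonzero: "b \<noteq> 0"
  by (simp_all add: a_def b_def a_val_def b_val_def)

section \<open>The columns of \<open>S\<close> as sums of characters\<close>

primrec specG :: "('g, 'h) idx \<Rightarrow> 'g list" where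
  "specG IdxZero = [0]"
| "specG IdxPi = [0]"
| "specG (J1 p) = [g0]"
| "specG (Gstar g) = [g, - g]"
| "specG (J2 p) = []"
| "specG (Gammastar \<gamma>) = []"

primrec specH :: "('g, 'h) idx \<Rightarrow> 'h list" where
  "specH IdxZero = [0]"
| "specH IdxPi = [0]"
| "specH (J1 p) = []"
| "specH (Gstar g) = []"
| "specH (J2 p) = [\<gamma>0]"
| "specH (Gammastar \<gamma>) = [\<gamma>, - \<gamma>]"

text \<open>The rows \<open>J2\<close> and \<open>Gammastar\<close> carry the factor
  \<open>- b\<close>, while column \<open>IdxZero\<close> has the entries \<open>b / 2\<close> and
  \<open>b\<close> there; hence the sign -1 for this column alone.\<close>

definition sgnH :: "('g, 'h) idx \<Rightarrow> complex" where "sgnH i = (if i = IdxZero then - 1 else 1)"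

definition f :: "('g, 'h) idx \<Rightarrow> 'g \<Rightarrow> complex" where "f i = chars q1 (specG i)"
definition h :: "('g, 'h) idx \<Rightarrow> 'h \<Rightarrow> complex" where "h i w = sgnH i * chars q2 (specH i) w"

text \<open>The coefficient of \<open>\<epsilon> * \<sigma>\<close> in row
  \<open>J1 (g0, \<epsilon>)\<close>; \<open>\<mu>\<close> is its counterpart for row
  \<open>J2 (\<gamma>0, \<epsilon>)\<close>.\<close>

primrec \<kappa> :: "('g, 'h) idx \<Rightarrow> complex" where
  "\<kappa> IdxZero = 0"
| "\<kappa> IdxPi = 0"
| "\<kappa> (J1 p) = of_int (snd p) * e"
| "\<kappa> (Gstar g) = 0"
| "\<kappa> (J2 p) = of_int (snd p)"
| "\<kappa> (Gammastar \<gamma>) = 0"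

primrec \<mu> :: "('g, 'h) idx \<Rightarrow> complex" where
  "\<mu> IdxZero = 0"
| "\<mu> IdxPi = 0"
| "\<mu> (J1 p) = of_int (snd p)"
| "\<mu> (Gstar g) = 0"
| "\<mu> (J2 p) = - (of_int (snd p) * e)"
| "\<mu> (Gammastar \<gamma>) = 0"

lemma I_cases:
  assumes "i \<in> I"
  obtains "i = IdxZero" | "i = IdxPi" | \<epsilon> where "i = J1 (g0, \<epsilon>)" "\<epsilon> = 1 \<or> \<epsilon> = -1"
  | g where "i = Gstar g" "g \<in> Gs" | \<epsilon> where "i = J2 (\<gamma>0, \<epsilon>)" "\<epsilon> = 1 \<or> \<epsilon> = -1"
  | \<gamma> where "i = Gammastar \<gamma>" "\<gamma> \<in> \<Gamma>s"
  using assms unfolding J_def by blast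

lemma group_index_in_I [simp]: "Gstar g \<in> I \<longleftrightarrow> g \<in> Gs" "Gammastar \<gamma> \<in> I \<longleftrightarrow> \<gamma> \<in> \<Gamma>s"
  by (auto simp: J_def)

lemma bichar_g0_uminus: "bichar q1 g0 (- g) = bichar q1 g0 g"
  and bichar_\<gamma>0_uminus: "bichar q2 \<gamma>0 (- \<gamma>) = bichar q2 \<gamma>0 \<gamma>"
  using bichar_minus_left[OF mg1, of g0] bichar_minus_left[OF mg2, of \<gamma>0] by simp_all

lemma S_rows:
  assumes "i \<in> I"
  shows "S IdxZero i = (a * f i 0 + b * h i 0) / 2"
    and "S IdxPi i = (a * f i 0 - b * h i 0) / 2"
    and "S (J1 (g0, \<epsilon>)) i = a / 2 * f i g0 + of_int \<epsilon> * (\<sigma> * \<kappa> i)"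
    and "S (Gstar g) i = a * f i g"
    and "S (J2 (\<gamma>0, \<epsilon>)) i = - (b / 2 * h i \<gamma>0) + of_int \<epsilon> * (\<sigma> * \<mu> i)"
    and "S (Gammastar \<gamma>) i = - (b * h i \<gamma>)"
  by (rule I_cases[OF assms];
      simp add: a_def b_def f_def h_def sgnH_def mg1 mg2 t_val_eq bichar_g0 bichar_\<gamma>0 bichar_g0_uminus
        bichar_\<gamma>0_uminus cnj_bichar algebra_simps add_divide_distrib diff_divide_distrib)+

lemma f_uminus: "i \<in> I \<Longrightarrow> f i (- w) = f i w"
  by (erule I_cases) (simp_all add: f_def mg1 bichar_minus_left)

lemma h_uminus: "i \<in> I \<Longrightarrow> h i (- w) = h i w"
  by (erule I_cases) (simp_all add: h_def mg2 bichar_minus_left)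

lemma sum_I: "(\<Sum>w\<in>I. \<phi> w) = \<phi> IdxZero + \<phi> IdxPi + (\<phi> (J1 (g0, 1)) + \<phi> (J1 (g0, -1)))
   + (\<Sum>w\<in>Gs. \<phi> (Gstar w)) + (\<phi> (J2 (\<gamma>0, 1)) + \<phi> (J2 (\<gamma>0, -1))) + (\<Sum>w\<in>\<Gamma>s. \<phi> (Gammastar w))"
  for \<phi> :: "('g, 'h) idx \<Rightarrow> complex"
proof -
  have "J1 ` ({g0} \<times> {1, -1}) = {J1 (g0, 1), J1 (g0, -1)}"
    "J2 ` ({\<gamma>0} \<times> {1, -1}) = {J2 (\<gamma>0, 1), J2 (\<gamma>0, -1)}" by auto
  then show ?thesis unfolding J_def
    by (subst sum.union_disjoint | force | subst sum.reindex | simp add: inj_on_def)+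
qed

section \<open>A closed formula for \<open>N\<close>\<close>

definition PG :: "('g, 'h) idx \<Rightarrow> ('g, 'h) idx \<Rightarrow> ('g, 'h) idx \<Rightarrow> complex" where
  "PG i j k = of_nat (zero_sums (specG i) (specG j) (specG k))"
definition PH :: "('g, 'h) idx \<Rightarrow> ('g, 'h) idx \<Rightarrow> ('g, 'h) idx \<Rightarrow> complex" where
  "PH i j k = sgnH i * sgnH j * sgnH k * of_nat (zero_sums (specH i) (specH j) (specH k))"

text \<open>What the parts quadratic in \<open>\<sigma>\<close> of the rows \<open>J1\<close> and
  \<open>J2\<close> contribute, with \<open>\<sigma> * \<sigma>\<close> already replaced by
  \<open>e / 8\<close>.\<close>

definition K :: "('g, 'h) idx \<Rightarrow> ('g, 'h) idx \<Rightarrow> ('g, 'h) idx \<Rightarrow> complex" where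
  "K i j k = e * (f i g0 * \<kappa> j * \<kappa> k + f j g0 * \<kappa> i * \<kappa> k + f k g0 * \<kappa> i * \<kappa> j
           - (h i \<gamma>0 * \<mu> j * \<mu> k + h j \<gamma>0 * \<mu> i * \<mu> k + h k \<gamma>0 * \<mu> i * \<mu> j))"

text \<open>The sums over \<open>Gs\<close> and \<open>\<Gamma>s\<close> are the full sums without
  the values at 0 and at the involution. The missing values at \<open>g0\<close> and
  \<open>\<gamma>0\<close> cancel against the rows \<open>J1\<close> and \<open>J2\<close>; those at
  0 remain as the terms in \<open>a * a / 2\<close> and \<open>b * b / 2\<close>.\<close>

lemma N_expand:
  assumes "i \<in> I" "j \<in> I" "k \<in> I"
  shows "N i j k =
     (a * f i 0 + b * h i 0) * (a * f j 0 + b * h j 0) * (a * f k 0 + b * h k 0) / (4 * (a - b))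
   + (a * f i 0 - b * h i 0) * (a * f j 0 - b * h j 0) * (a * f k 0 - b * h k 0) / (4 * (a + b))
   - a * a / 2 * (f i 0 * f j 0 * f k 0) + b * b / 2 * (h i 0 * h j 0 * h k 0)
   + PG i j k / 2 - PH i j k / 2 + K i j k / 4"
proof -
  have G: "(\<Sum>w\<in>Gs. f i w * f j w * f k w) =
      (of_nat CARD('g) * PG i j k - f i 0 * f j 0 * f k 0 - f i g0 * f j g0 * f k g0) / 2"
  proof -
    have "(\<Sum>w\<in>UNIV. f i w * f j w * f k w) = of_nat CARD('g) * PG i j k"
      using sum_chars[OF mg1, of "specG i" "specG j" "specG k"] by (simp add: f_def PG_def)
    moreover have "(\<Sum>w\<in>UNIV. f i w * f j w * f k w) = f i 0 * f j 0 * f k 0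
        + f i g0 * f j g0 * f k g0 + 2 * (\<Sum>w\<in>Gs. f i w * f j w * f k w)"
      by (rule sum_half_system[OF half1 tors1 g0]) (simp add: f_uminus assms)
    ultimately show ?thesis by (simp add: algebra_simps)
  qed
  have H: "(\<Sum>w\<in>\<Gamma>s. h i w * h j w * h k w) =
      (of_nat CARD('h) * PH i j k - h i 0 * h j 0 * h k 0 - h i \<gamma>0 * h j \<gamma>0 * h k \<gamma>0) / 2"
  proof -
    have "(\<Sum>w\<in>UNIV. h i w * h j w * h k w) = sgnH i * sgnH j * sgnH k *
       (\<Sum>w\<in>UNIV. chars q2 (specH i) w * chars q2 (specH j) w * chars q2 (specH k) w)"
      unfolding h_def sum_distrib_left by (rule sum.cong) (simp_all add: algebra_simps)
    then have "(\<Sum>w\<in>UNIV. h i w * h j w * h k w) = of_nat CARD('h) * PH i j k"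
      unfolding sum_chars[OF mg2] by (simp add: PH_def)
    moreover have "(\<Sum>w\<in>UNIV. h i w * h j w * h k w) = h i 0 * h j 0 * h k 0
        + h i \<gamma>0 * h j \<gamma>0 * h k \<gamma>0 + 2 * (\<Sum>w\<in>\<Gamma>s. h i w * h j w * h k w)"
      by (rule sum_half_system[OF half2 tors2 \<gamma>0]) (simp add: h_uminus assms)
    ultimately show ?thesis by (simp add: algebra_simps)
  qed
  have G': "(\<Sum>w\<in>Gs. S (Gstar w) i * S (Gstar w) j * S (Gstar w) k / S IdxZero (Gstar w)) =
     PG i j k / 2 - a * a / 2 * (f i 0 * f j 0 * f k 0) - a * a / 2 * (f i g0 * f j g0 * f k g0)"
  proof -
    have "(\<Sum>w\<in>Gs. S (Gstar w) i * S (Gstar w) j * S (Gstar w) k / S IdxZero (Gstar w)) =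
      a * a * (\<Sum>w\<in>Gs. f i w * f j w * f k w)"
      unfolding sum_distrib_left
      by (rule sum.cong) (use a_nonzero in \<open>simp_all add: S_rows assms flip: a_def b_def\<close>)
    also have "\<dots> = (a * a * of_nat CARD('g)) * PG i j k / 2 - a * a / 2 * (f i 0 * f j 0 * f k 0)
         - a * a / 2 * (f i g0 * f j g0 * f k g0)"
      unfolding G by (simp add: field_simps)
    also have "a * a * of_nat CARD('g) = 1" by (simp add: a_sq)
    finally show ?thesis by simp
  qed
  have H': "(\<Sum>w\<in>\<Gamma>s. S (Gammastar w) i * S (Gammastar w) j * S (Gammastar w) k / S IdxZero (Gammastar w)) =
     - (PH i j k / 2) + b * b / 2 * (h i 0 * h j 0 * h k 0) + b * b / 2 * (h i \<gamma>0 * h j \<gamma>0 * h k \<gamma>0)"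
  proof -
    have "(\<Sum>w\<in>\<Gamma>s. S (Gammastar w) i * S (Gammastar w) j * S (Gammastar w) k / S IdxZero (Gammastar w)) =
      - (b * b) * (\<Sum>w\<in>\<Gamma>s. h i w * h j w * h k w)"
      unfolding sum_distrib_left
      by (rule sum.cong) (use b_nonzero in \<open>simp_all add: S_rows assms flip: a_def b_def\<close>)
    also have "\<dots> = - ((b * b * of_nat CARD('h)) * PH i j k / 2) + b * b / 2 * (h i 0 * h j 0 * h k 0)
         + b * b / 2 * (h i \<gamma>0 * h j \<gamma>0 * h k \<gamma>0)"
      unfolding H by (simp add: field_simps)
    also have "b * b * of_nat CARD('h) = 1" by (simp add: b_sq)
    finally show ?thesis by simp
  qed
  have ss: "\<sigma> * p * (\<sigma> * q) = e / 8 * (p * q)" for p q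
    using sigma_sq by (simp add: mult_ac)
  \<comment> \<open>Adding the rows for both signs \<open>\<epsilon>\<close> leaves only the terms
    of even degree in \<open>\<sigma>\<close>. The denominator \<open>a/2\<close> is the entry of
    \<open>S IdxZero\<close> at \<open>J1\<close>.\<close>
  have pm: "(a/2 * x + \<sigma> * p) * (a/2 * y + \<sigma> * q) * (a/2 * z + \<sigma> * r) / (a/2)
      + (a/2 * x - \<sigma> * p) * (a/2 * y - \<sigma> * q) * (a/2 * z - \<sigma> * r) / (a/2)
      = a * a / 2 * (x * y * z) + e / 4 * (x * q * r + y * p * r + z * p * q)" for x y z p q r
  proof -
    have *: "(a/2 * x + p) * (a/2 * y + q) * (a/2 * z + r) / (a/2)
      + (a/2 * x - p) * (a/2 * y - q) * (a/2 * z - r) / (a/2)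
      = a * a / 2 * (x * y * z) + 2 * (x * (q * r) + y * (p * r) + z * (p * q))" for p q r
      using a_nonzero by (simp add: field_simps)
    show ?thesis unfolding * ss by (simp add: algebra_simps)
  qed
  have pm': "(- (b/2 * x) + \<sigma> * p) * (- (b/2 * y) + \<sigma> * q) * (- (b/2 * z) + \<sigma> * r) / (b/2)
      + (- (b/2 * x) - \<sigma> * p) * (- (b/2 * y) - \<sigma> * q) * (- (b/2 * z) - \<sigma> * r) / (b/2)
      = - (b * b / 2 * (x * y * z)) - e / 4 * (x * q * r + y * p * r + z * p * q)" for x y z p q r
  proof -
    have *: "(- (b/2 * x) + p) * (- (b/2 * y) + q) * (- (b/2 * z) + r) / (b/2)
      + (- (b/2 * x) - p) * (- (b/2 * y) - q) * (- (b/2 * z) - r) / (b/2)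
      = - (b * b / 2 * (x * y * z)) - 2 * (x * (q * r) + y * (p * r) + z * (p * q))" for p q r
      using b_nonzero by (simp add: field_simps)
    show ?thesis unfolding * ss by (simp add: algebra_simps)
  qed
  have J1: "S (J1 (g0, 1)) i * S (J1 (g0, 1)) j * S (J1 (g0, 1)) k / S IdxZero (J1 (g0, 1))
    + S (J1 (g0, -1)) i * S (J1 (g0, -1)) j * S (J1 (g0, -1)) k / S IdxZero (J1 (g0, -1)) =
    a * a / 2 * (f i g0 * f j g0 * f k g0)
     + e / 4 * (f i g0 * \<kappa> j * \<kappa> k + f j g0 * \<kappa> i * \<kappa> k + f k g0 * \<kappa> i * \<kappa> j)"
    using pm[of "f i g0" "\<kappa> i" "f j g0" "\<kappa> j" "f k g0" "\<kappa> k"]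
    by (simp only: S_rows(3) assms S_mat.simps a_def[symmetric] b_def[symmetric] of_int_1 of_int_minus mult_1 mult_minus1 add_uminus_conv_diff)
  have J2: "S (J2 (\<gamma>0, 1)) i * S (J2 (\<gamma>0, 1)) j * S (J2 (\<gamma>0, 1)) k / S IdxZero (J2 (\<gamma>0, 1))
    + S (J2 (\<gamma>0, -1)) i * S (J2 (\<gamma>0, -1)) j * S (J2 (\<gamma>0, -1)) k / S IdxZero (J2 (\<gamma>0, -1)) =
    - (b * b / 2 * (h i \<gamma>0 * h j \<gamma>0 * h k \<gamma>0))
     - e / 4 * (h i \<gamma>0 * \<mu> j * \<mu> k + h j \<gamma>0 * \<mu> i * \<mu> k + h k \<gamma>0 * \<mu> i * \<mu> j)"
    using pm'[of "h i \<gamma>0" "\<mu> i" "h j \<gamma>0" "\<mu> j" "h k \<gamma>0" "\<mu> k"]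
    by (simp only: S_rows(5) assms S_mat.simps a_def[symmetric] b_def[symmetric] of_int_1 of_int_minus mult_1 mult_minus1 add_uminus_conv_diff)
  \<comment> \<open>For \<open>w = 0\<close> both sides are 0, so the case \<open>a = b\<close> is
    covered as well.\<close>
  have half: "(x / 2) * (y / 2) * (z / 2) / (w / 2) = x * y * z / (4 * w)" for x y z w :: complex
    by simp
  have Z: "S IdxZero i * S IdxZero j * S IdxZero k / S IdxZero IdxZero =
     (a * f i 0 + b * h i 0) * (a * f j 0 + b * h j 0) * (a * f k 0 + b * h k 0) / (4 * (a - b))"
    and P: "S IdxPi i * S IdxPi j * S IdxPi k / S IdxZero IdxPi =
     (a * f i 0 - b * h i 0) * (a * f j 0 - b * h j 0) * (a * f k 0 - b * h k 0) / (4 * (a + b))"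
    by (simp_all only: S_rows assms S_mat.simps a_def[symmetric] b_def[symmetric] half)
  show ?thesis
    unfolding verlinde_def sum_I J1 J2 G' H' Z P K_def
    by (simp add: algebra_simps add_divide_distrib diff_divide_distrib)
qed

text \<open>Over the common denominator \<open>a * a - b * b\<close> the terms free of
  \<open>PG\<close>, \<open>PH\<close> and \<open>K\<close> acquire the factor
  \<open>(a * a) * (b * b)\<close>. As \<open>a * a\<close> and \<open>b * b\<close> are the
  reciprocals of the orders, the quotient is the reciprocal of
  \<open>|\<Gamma>| - |G|\<close>.\<close>

lemma N_formula:
  assumes "i \<in> I" "j \<in> I" "k \<in> I" and ne: "CARD('g) \<noteq> CARD('h)"
  shows "N i j k = (f i 0 + h i 0) * (f j 0 + h j 0) * (f k 0 + h k 0)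
        / (2 * of_int (int CARD('h) - int CARD('g))) + PG i j k / 2 - PH i j k / 2 + K i j k / 4"
proof -
  define A B where "A = (of_nat CARD('g) :: complex)" and "B = (of_nat CARD('h) :: complex)"
  have AB: "A \<noteq> 0" "B \<noteq> 0" "A \<noteq> B" using ne by (simp_all add: A_def B_def)
  have "a * a - b * b = (B - A) / (A * B)"
    using AB by (simp add: a_sq b_sq A_def B_def field_simps)
  moreover have "(a * a) * (b * b) = 1 / (A * B)" by (simp add: a_sq b_sq A_def B_def)
  ultimately have q: "(a * a) * (b * b) / (a * a - b * b) = 1 / (B - A)"
    and nz: "a * a - b * b \<noteq> 0" using AB by simp_all
  have d: "a - b \<noteq> 0" "a + b \<noteq> 0"
    using nz by (auto simp: square_diff_square_factored)
  have "(a * x + b * x') * (a * y + b * y') * (a * z + b * z') / (4 * (a - b))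
   + (a * x - b * x') * (a * y - b * y') * (a * z - b * z') / (4 * (a + b))
   - a * a / 2 * (x * y * z) + b * b / 2 * (x' * y' * z')
   = (a * a) * (b * b) / (a * a - b * b) * ((x + x') * (y + y') * (z + z') / 2)" for x y z x' y' z'
  proof -
    define X Y u v t where "X = (a * x + b * x') * (a * y + b * y') * (a * z + b * z')"
      and "Y = (a * x - b * x') * (a * y - b * y') * (a * z - b * z')"
      and "u = x * y * z" and "v = x' * y' * z'" and "t = (x + x') * (y + y') * (z + z')"
    define D where "D = (a + b) * (a - b)"
    have D: "D \<noteq> 0" "a * a - b * b = D" using d by (simp_all add: D_def square_diff_square_factored)
    have "X / (4 * (a - b)) = X * (a + b) / (4 * D)" "Y / (4 * (a + b)) = Y * (a - b) / (4 * D)"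
      using d by (simp_all add: D_def)
    \<comment> \<open>In \<open>X * (a + b) + Y * (a - b)\<close> only even powers of
      \<open>b\<close> survive. The terms in \<open>u\<close> and \<open>v\<close> cancel the fourth
      powers of \<open>a\<close> and \<open>b\<close> and complete the rest to the expansion of
      \<open>t\<close>.\<close>
    moreover have "X * (a + b) + Y * (a - b) - 2 * D * (a * a) * u + 2 * D * (b * b) * v
        = 2 * ((a * a) * (b * b) * t)"
      unfolding X_def Y_def u_def v_def t_def D_def by algebra
    then have "(X * (a + b) + Y * (a - b) - 2 * D * (a * a) * u + 2 * D * (b * b) * v) / (4 * D)
        = (a * a) * (b * b) / D * (t / 2)" by (simp add: mult_ac)
    then have "X * (a + b) / (4 * D) + Y * (a - b) / (4 * D) - a * a / 2 * u + b * b / 2 * v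
        = (a * a) * (b * b) / D * (t / 2)"
      using D(1) by (simp add: add_divide_distrib diff_divide_distrib mult_ac)
    ultimately show ?thesis unfolding D(2) by (simp add: X_def Y_def u_def v_def t_def)
  qed
  then show ?thesis unfolding N_expand[OF assms(1-3)] q
    by (simp add: A_def B_def)
qed

lemma N_swap: "N i j k = N j i k" "N i j k = N i k j"
  by (simp_all add: verlinde_def mult_ac)

lemma pi_in_I: "IdxPi \<in> I" and J1_in_I: "J1 (g0, 1) \<in> I"
  by (auto simp: J_def)

lemmas eval_simps = f_def h_def sgnH_def K_def PG_def PH_def zero_sums_def chars_zero mg1 mg2

section \<open>Natural coefficients force the difference 2\<close>

lemma order_difference_if_natural:
  assumes "\<forall>i\<in>I. \<forall>j\<in>I. \<forall>k\<in>I. N i j k \<in> \<nat>"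
  shows "int CARD('h) - int CARD('g) = 2"
proof (cases "CARD('g) = CARD('h)")
  case True
  \<comment> \<open>Here \<open>S IdxZero IdxZero = 0\<close>, so the term of \<open>IdxZero\<close> is 0 by the convention \<open>x / 0 = 0\<close>, and this makes
    one coefficient negative.\<close>
  then have "a = b" by (simp add: a_def b_def a_val_def b_val_def)
  then have "N IdxPi IdxPi (J1 (g0, 1)) = - (a * a / 2)"
    using g0 by (simp add: N_expand pi_in_I J1_in_I eval_simps)
  also have "\<dots> = of_real (- (1 / (2 * real CARD('g))))" by (simp add: a_sq)
  finally have "complex_of_real (- (1 / (2 * real CARD('g)))) \<in> \<nat>"
    using assms pi_in_I J1_in_I by metis
  then obtain n where "complex_of_real (- (1 / (2 * real CARD('g)))) = of_nat n" by (auto elim: Nats_cases)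
  then have "- (1 / (2 * real CARD('g))) = real n" by (metis of_real_eq_iff of_real_of_nat_eq)
  moreover have "- (1 / (2 * real CARD('g))) < 0" by simp
  ultimately show ?thesis by simp
next
  case False
  define d where "d = int CARD('h) - int CARD('g)"
  have d: "d \<noteq> 0" using False by (simp add: d_def)
  have "N IdxPi IdxPi (J1 (g0, 1)) = 2 / of_int d"
    using g0 by (simp add: N_formula[OF _ _ _ False, folded d_def] pi_in_I J1_in_I eval_simps)
  then obtain n where "2 / of_int d = (of_nat n :: complex)"
    using assms pi_in_I J1_in_I by (metis Nats_cases)
  then have "(of_int (int n * d) :: complex) = of_int 2" using d by (simp add: field_simps)
  then have nd: "int n * d = 2" by (simp only: of_int_eq_iff)
  \<comment> \<open>The summand 1/2 comes from the solution \<open>0 + g0 + g0 = 0\<close>; in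
    \<open>K\<close> the two groups contribute \<open>e\<close> and \<open>- e\<close>, which
    cancel.\<close>
  have "N IdxPi (J1 (g0, 1)) (J1 (g0, 1)) = 1 / of_int d + 1 / 2"
    using g0 e_cases by (auto simp: N_formula[OF _ _ _ False, folded d_def] pi_in_I J1_in_I eval_simps)
  then obtain m where "1 / of_int d + 1 / 2 = (of_nat m :: complex)"
    using assms pi_in_I J1_in_I by (metis Nats_cases)
  then have "(of_int (2 + d) :: complex) = of_int (2 * int m * d)" using d by (simp add: field_simps)
  then have md: "2 + d = 2 * int m * d" by (simp only: of_int_eq_iff)
  have "d > 0" using nd by (metis mult_nonneg_nonpos not_le of_nat_0_le_iff zero_less_numeral)
  moreover have "d \<le> 2" using nd by (intro zdvd_imp_le) (metis dvd_triv_right, simp)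
  \<comment> \<open>For \<open>d = 1\<close> the second coefficient would be 3/2.\<close>
  moreover have "d \<noteq> 1"
  proof
    assume "d = 1"
    then have "3 = 2 * int m" using md by simp
    then show False by presburger
  qed
  ultimately show ?thesis unfolding d_def by linarith
qed

section \<open>The difference 2 makes every coefficient natural\<close>

text \<open>The value of \<open>N i j k\<close> when \<open>|\<Gamma>| - |G| = 2\<close>.\<close>

definition Q :: "('g, 'h) idx \<Rightarrow> ('g, 'h) idx \<Rightarrow> ('g, 'h) idx \<Rightarrow> complex" where
  "Q i j k = (f i 0 + h i 0) * (f j 0 + h j 0) * (f k 0 + h k 0) / 4
      + PG i j k / 2 - PH i j k / 2 + K i j k / 4"

lemma double_Gs: "g \<in> Gs \<Longrightarrow> g + g \<noteq> 0" and double_\<Gamma>s: "\<gamma> \<in> \<Gamma>s \<Longrightarrow> \<gamma> + \<gamma> \<noteq> 0"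
  using half1 half2 unfolding half_system_def two_torsion_def by auto

lemmas Q_simps = Q_def f_def h_def sgnH_def K_def PG_def PH_def chars_zero mg1 mg2
  bichar_g0_uminus bichar_\<gamma>0_uminus bichar_g0 bichar_\<gamma>0 zero_sums_involution2 double_Gs double_\<Gamma>s

text \<open>A finite check over \<open>e\<close> and the signs. Three indices in \<open>J1\<close>,
  for example, give \<open>(1 + p) / 4\<close>, where \<open>p\<close> is the sum of the pairwise
  products of the signs, hence 3 or -1.\<close>

lemma Q_no_group:
  assumes "i \<in> I" "j \<in> I" "k \<in> I" "\<And>x. x \<in> {i, j, k} \<Longrightarrow> x \<notin> range Gstar \<and> x \<notin> range Gammastar"
  shows "Q i j k \<in> \<nat>"
  using assms e_cases g0 \<gamma>0
  by (elim I_cases; force simp: Q_simps zero_sums_def)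

text \<open>Both \<open>J1\<close> and \<open>J2\<close> precede \<open>Gstar\<close> and
  \<open>Gammastar\<close>, so that in a sorted triple the indices with a free group element come
  last.\<close>

fun block :: "('g, 'h) idx \<Rightarrow> nat" where
  "block IdxZero = 0"
| "block IdxPi = 1"
| "block (J1 p) = 2"
| "block (J2 p) = 3"
| "block (Gstar g) = 4"
| "block (Gammastar \<gamma>) = 5"

text \<open>Both counts vanish. When \<open>i\<close> and \<open>j\<close> both lie in
  \<open>J1\<close> or \<open>J2\<close>, the product term is 1/2 and \<open>K / 4\<close> is 1/2 or
  -1/2, because characters are \<open>\<plusminus>1\<close> at an involution; otherwise
  \<open>K = 0\<close>.\<close>

lemma Q_one_group:
  assumes "i \<in> I" "j \<in> I" "i \<notin> range Gstar" "i \<notin> range Gammastar"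
     "j \<notin> range Gstar" "j \<notin> range Gammastar" "k \<in> I" "k \<in> range Gstar \<union> range Gammastar"
  shows "Q i j k \<in> \<nat>"
proof -
  consider g where "k = Gstar g" "g \<in> Gs" | \<gamma> where "k = Gammastar \<gamma>" "\<gamma> \<in> \<Gamma>s"
    using assms(7,8) by (elim I_cases) auto
  then show ?thesis
  proof cases
    case 1
    show ?thesis
      using assms(1-6) bichar_involution(1)[OF mg1 double_g0, of g] e_cases 1
      by (elim I_cases; force simp: Q_simps)
  next
    case 2
    show ?thesis
      using assms(1-6) bichar_involution(1)[OF mg2 double_\<gamma>0, of \<gamma>] e_cases 2
      by (elim I_cases; force simp: Q_simps)
  qed
qed

text \<open>Every term of \<open>K\<close> contains a vanishing factor, and half of a count is 0 or
  1. On the side of \<open>\<Gamma>\<close> this half is subtracted from 2 for \<open>IdxPi\<close>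
  and from 1 for \<open>J2\<close>, and for \<open>IdxZero\<close> the sign \<open>sgnH\<close>
  turns it into an addition.\<close>

lemma Q_two_groups:
  assumes "i \<in> I" "i \<notin> range Gstar" "i \<notin> range Gammastar"
  shows "x \<in> Gs \<Longrightarrow> y \<in> Gs \<Longrightarrow> Q i (Gstar x) (Gstar y) \<in> \<nat>"
    and "u \<in> \<Gamma>s \<Longrightarrow> v \<in> \<Gamma>s \<Longrightarrow> Q i (Gammastar u) (Gammastar v) \<in> \<nat>"
    and "Q i (Gstar x) (Gammastar v) \<in> \<nat>"
proof -
  show "Q i (Gstar x) (Gstar y) \<in> \<nat>" if "x \<in> Gs" "y \<in> Gs"
    using assms zero_sums_involution1[of 0 y x] zero_sums_involution1[of g0 y x] that
    by (elim I_cases; force simp: Q_simps)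
  show "Q i (Gammastar u) (Gammastar v) \<in> \<nat>" if "u \<in> \<Gamma>s" "v \<in> \<Gamma>s"
    using assms zero_sums_involution1[of 0 v u] zero_sums_involution1[of \<gamma>0 v u] that
    by (elim I_cases; force simp: Q_simps)
  show "Q i (Gstar x) (Gammastar v) \<in> \<nat>"
    using assms by (elim I_cases; force simp: Q_simps)
qed

text \<open>The product term is \<open>2 * 2 * 2 / 4 = 2\<close>. The bound 4 on the count is just
  what keeps \<open>2 - PH / 2\<close> non-negative; in the mixed cases both counts are 0.\<close>

lemma Q_three_groups:
  shows "z \<in> Gs \<Longrightarrow> Q (Gstar x) (Gstar y) (Gstar z) \<in> \<nat>"
    and "w \<in> \<Gamma>s \<Longrightarrow> Q (Gammastar u) (Gammastar v) (Gammastar w) \<in> \<nat>"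
    and "Q (Gstar x) (Gstar y) (Gammastar w) \<in> \<nat>"
    and "Q (Gstar x) (Gammastar v) (Gammastar w) \<in> \<nat>"
  using zero_sums_no_involution[of z x y] zero_sums_no_involution[of w u v]
  by (auto simp: Q_simps)

lemma Q_sorted:
  assumes "i \<in> I" "j \<in> I" "k \<in> I" "block i \<le> block j" "block j \<le> block k"
  shows "Q i j k \<in> \<nat>"
proof -
  note I = assms(1-3)
  consider "k \<notin> range Gstar" "k \<notin> range Gammastar"
    | "k \<in> range Gstar \<union> range Gammastar" "j \<notin> range Gstar" "j \<notin> range Gammastar"
    | "k \<in> range Gstar \<union> range Gammastar" "j \<in> range Gstar \<union> range Gammastar" "i \<notin> range Gstar" "i \<notin> range Gammastar"
    | "k \<in> range Gstar \<union> range Gammastar" "j \<in> range Gstar \<union> range Gammastar" "i \<in> range Gstar \<union> range Gammastar"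
    by blast
  then show ?thesis
  proof cases
    case 1
    have "j \<notin> range Gstar" "j \<notin> range Gammastar" "i \<notin> range Gstar" "i \<notin> range Gammastar"
      using assms 1 by (auto elim!: I_cases)
    with 1 show ?thesis by (intro Q_no_group I) auto
  next
    case 2
    then have "i \<notin> range Gstar" "i \<notin> range Gammastar"
      using assms 2 by (auto elim!: I_cases)
    with 2 show ?thesis using I by (intro Q_one_group)
  next
    case 3
    then show ?thesis using I assms(5) Q_two_groups by auto
  next
    case 4
    then show ?thesis using I assms(4,5) Q_three_groups by auto
  qed
qed

lemma natural_if_order_difference:
  assumes d: "int CARD('h) - int CARD('g) = 2" and I: "i \<in> I" "j \<in> I" "k \<in> I"
  shows "N i j k \<in> \<nat>"
proof -
  have ne: "CARD('g) \<noteq> CARD('h)" using d by auto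
  have "i \<in> I \<longrightarrow> j \<in> I \<longrightarrow> k \<in> I \<longrightarrow> N i j k \<in> \<nat>"
  proof (rule symmetric_wlog[where r = block and i = i and j = j and k = k])
    fix i j k assume "block i \<le> block j" "block j \<le> block k"
    then show "i \<in> I \<longrightarrow> j \<in> I \<longrightarrow> k \<in> I \<longrightarrow> N i j k \<in> \<nat>"
      using Q_sorted[of i j k] by (auto simp: N_formula[OF _ _ _ ne] d Q_def)
  qed (use N_swap in metis)+
  then show ?thesis using I by blast
qed

end

theorem theorem4p4:
  fixes q1 :: "'g::{finite, ab_group_add} \<Rightarrow> complex"
    and q2 :: "'h::{finite, ab_group_add} \<Rightarrow> complex"
    and g0 :: 'g and \<gamma>0 :: 'h
    and Gs :: "'g set" and \<Gamma>s :: "'h set"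
    and c :: complex
  assumes "metric_group q1" and "metric_group q2"
    and "two_torsion = {0, g0}" and "g0 \<noteq> 0"
    and "two_torsion = {0, \<gamma>0}" and "\<gamma>0 \<noteq> 0"
    and "c = gauss_sum q1" and "c = - gauss_sum q2"
    and "bichar q1 g0 g0 = - bichar q2 \<gamma>0 \<gamma>0"
    and "c\<^sup>2 = inverse (q1 g0) * q2 \<gamma>0"
    and "half_system Gs" and "half_system \<Gamma>s"
  shows "(\<forall>i \<in> J g0 \<gamma>0 Gs \<Gamma>s. \<forall>j \<in> J g0 \<gamma>0 Gs \<Gamma>s. \<forall>k \<in> J g0 \<gamma>0 Gs \<Gamma>s.
            verlinde (J g0 \<gamma>0 Gs \<Gamma>s) (S_mat q1 q2 g0 \<gamma>0) IdxZero i j k \<in> \<nat>)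
         \<longleftrightarrow> int CARD('h) - int CARD('g) = 2"
proof -
  interpret metric_pair q1 q2 g0 \<gamma>0 Gs \<Gamma>s
    by unfold_locales (use assms in auto)
  show ?thesis using order_difference_if_natural natural_if_order_difference by blast
qed

end
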